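(* Let $m$ be a nonnegative integer, let $\{a_n\}_{n\ge0}$ be a sequence of real (or complex) numbers and let $\varepsilon\in\{1,-1\}$. Then $$\sum_{k=0}^n\binom{n-m-1}{k}(-1)^{n-k}a_{n-k}=\varepsilon a_n\quad(n=0,1,2,\ldots)$$ holds if and only if both $$\sum_{k=0}^n\binom nk\frac{a_k}{\binom mk}=\varepsilon(-1)^n\frac{a_n}{\binom mn}\quad(n=0,1,\ldots,m)$$ and $$\sum_{k=0}^n\binom nk(-1)^ka_{k+m+1}=\varepsilon(-1)^{m+1}a_{n+m+1}\quad(n=0,1,2,\ldots)$$ hold.
   Context: For real $x$ and a nonnegative integer $k$, $\binom xk=x(x-1)\cdots(x-k+1)/k!$ (with $\binom x0=1$). *)

theory Defs
  imports Complex_Main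
begin

end

theory Submission
  imports Defs
begin

text \<open>The equivalence holds separately for each \<open>n\<close>. If \<open>n \<le> m\<close>, negating the upper index turns the
  coefficient of \<open>a\<^sub>j\<close> into \<open>(-1)\<^sup>n\<close> times the binomial coefficient \<open>m - j\<close> over \<open>n - j\<close>,
  which trinomial revision rewrites as a quotient. If \<open>n = N + m + 1\<close>, the upper index is the natural
  number \<open>N\<close>, so only the terms \<open>a\<^sub>j\<close> with \<open>j > m\<close> survive.\<close>

lemma gbinomial_sum_le:
  fixes a :: "nat \<Rightarrow> 'a::field_char_0"
  assumes "n \<le> m"
  shows "(\<Sum>k=0..n. ((of_nat n - of_nat m - 1) gchoose k) * (-1) ^ (n - k) * a (n - k))
    = (-1) ^ n * of_nat (m choose n) * (\<Sum>j=0..n. of_nat (n choose j) * (a j / of_nat (m choose j)))"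
proof -
  have "((of_nat n - of_nat m - 1) gchoose (n - j)) * (-1) ^ j * a j
      = (-1) ^ n * of_nat (m choose n) * (of_nat (n choose j) * (a j / of_nat (m choose j)))"
    if "j \<le> n" for j
  proof -
    \<comment> \<open>Negation turns \<open>x gchoose k\<close> into \<open>(-1) ^ k\<close> times
      \<open>(k - x - 1) gchoose k\<close>; here \<open>k = n - j\<close> and
      \<open>x = n - m - 1\<close>. No subtraction truncates, as
      \<open>j \<le> n \<le> m\<close>.\<close>
    have upper: "of_nat (n - j) - (of_nat n - of_nat m - 1) - 1 = (of_nat (m - j) :: 'a)"
      using that assms by (simp add: of_nat_diff)
    have gchoose: "((of_nat n - of_nat m - 1 :: 'a) gchoose (n - j))
        = (-1) ^ (n - j) * of_nat ((m - j) choose (n - j))"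
      by (subst gbinomial_negated_upper) (simp only: upper binomial_gbinomial)
    have revision: "(of_nat (m choose n) * of_nat (n choose j) :: 'a)
        = of_nat (m choose j) * of_nat ((m - j) choose (n - j))"
      using choose_mult[OF that assms] by (simp flip: of_nat_mult)
    have sign: "((-1) ^ (n - j) * (-1) ^ j :: 'a) = (-1) ^ n"
      using that by (simp flip: power_add)
    have nonzero: "(of_nat (m choose j) :: 'a) \<noteq> 0"
      using that assms by simp
    have "((of_nat n - of_nat m - 1) gchoose (n - j)) * (-1) ^ j * a j
        = ((-1) ^ (n - j) * (-1) ^ j) * of_nat ((m - j) choose (n - j)) * a j"
      by (simp add: gchoose)
    also have "\<dots> = (-1) ^ n * (of_nat (m choose j) * of_nat ((m - j) choose (n - j)))
        * (a j / of_nat (m choose j))"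
      using nonzero by (simp add: sign)
    also have "\<dots> = (-1) ^ n * of_nat (m choose n) * (of_nat (n choose j) * (a j / of_nat (m choose j)))"
      by (simp flip: revision)
    finally show ?thesis .
  qed
  then show ?thesis
    \<comment> \<open>Reversal puts \<open>k = n - j\<close>, so that the sum runs over the index of
      \<open>a\<close>.\<close>
    by (subst sum.atLeastAtMost_rev) (simp add: sum_distrib_left)
qed

lemma gbinomial_sum_gt:
  fixes a :: "nat \<Rightarrow> 'a::field_char_0"
  shows "(\<Sum>k=0..N + m + 1. ((of_nat (N + m + 1) - of_nat m - 1) gchoose k)
            * (-1) ^ (N + m + 1 - k) * a (N + m + 1 - k))
    = (-1) ^ (m + 1) * (\<Sum>i=0..N. of_nat (N choose i) * (-1) ^ i * a (i + m + 1))"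
proof -
  have "(\<Sum>k=0..N + m + 1. ((of_nat (N + m + 1) - of_nat m - 1) gchoose k)
            * (-1) ^ (N + m + 1 - k) * a (N + m + 1 - k))
      = (\<Sum>k=0..N + m + 1. of_nat (N choose k) * (-1) ^ (N + m + 1 - k) * a (N + m + 1 - k))"
    by (simp add: binomial_gbinomial)
  \<comment> \<open>The terms with \<open>k > N\<close>, which carry the \<open>a j\<close> with
    \<open>j \<le> m\<close>, vanish because \<open>N choose k = 0\<close>.\<close>
  also have "\<dots> = (\<Sum>k=0..N. of_nat (N choose k) * (-1) ^ (N + m + 1 - k) * a (N + m + 1 - k))"
    by (rule sum.mono_neutral_right) auto
  \<comment> \<open>Put \<open>k = N - i\<close>, so that
    \<open>N + m + 1 - k = i + m + 1\<close>.\<close>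
  also have "\<dots> = (\<Sum>i=0..N. of_nat (N choose (N - i)) * (-1) ^ (i + m + 1) * a (i + m + 1))"
    by (subst sum.atLeastAtMost_rev) (auto intro!: sum.cong simp: add.commute)
  also have "\<dots> = (-1) ^ (m + 1) * (\<Sum>i=0..N. of_nat (N choose i) * (-1) ^ i * a (i + m + 1))"
    unfolding sum_distrib_left
    by (intro sum.cong refl) (auto simp: power_add binomial_symmetric[symmetric])
  finally show ?thesis .
qed

theorem theorem2p4:
  fixes m :: nat and a :: "nat \<Rightarrow> 'a::real_normed_field" and \<epsilon> :: 'a
  assumes "\<epsilon> \<in> {1, -1}"
  shows "(\<forall>n. (\<Sum>k=0..n. ((of_nat n - of_nat m - 1) gchoose k) * (-1) ^ (n - k) * a (n - k)) = \<epsilon> * a n)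
    \<longleftrightarrow>
      (\<forall>n\<le>m. (\<Sum>k=0..n. of_nat (n choose k) * (a k / of_nat (m choose k)))
              = \<epsilon> * (-1) ^ n * (a n / of_nat (m choose n))) \<and>
      (\<forall>n. (\<Sum>k=0..n. of_nat (n choose k) * (-1) ^ k * a (k + m + 1))
              = \<epsilon> * (-1) ^ (m + 1) * a (n + m + 1))"
    (is "(\<forall>n. ?P n) \<longleftrightarrow> (\<forall>n\<le>m. ?Q n) \<and> (\<forall>n. ?R n)")
proof -
  \<comment> \<open>A power of \<open>-1\<close> is its own inverse; this moves the sign factor of
    either sum formula to the right-hand side.\<close>
  have sign: "(-1) ^ k * S = T \<longleftrightarrow> S = (-1) ^ k * T" for k and S T :: 'a
    by (cases "even k") auto
  have le: "?P n \<longleftrightarrow> ?Q n" if "n \<le> m" for n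
  proof -
    \<comment> \<open>Apart from the sign, \<open>?P n\<close> is \<open>?Q n\<close> multiplied by
      \<open>m choose n\<close>, which can be cancelled.\<close>
    have nonzero: "(of_nat (m choose n) :: 'a) \<noteq> 0"
      using that by simp
    show ?thesis
      unfolding gbinomial_sum_le[OF that] unfolding mult.assoc sign
      using nonzero by (auto simp: field_simps)
  qed
  have gt: "?P (n + m + 1) \<longleftrightarrow> ?R n" for n
    unfolding gbinomial_sum_gt sign by (simp only: mult_ac)
  \<comment> \<open>An index \<open>i > m\<close> is \<open>n + m + 1\<close> with
    \<open>n = i - m - 1\<close>, so \<open>le\<close> and \<open>gt\<close> cover every
    case.\<close>
  have split: "(\<forall>n. P n) \<longleftrightarrow> (\<forall>n\<le>m. P n) \<and> (\<forall>n. P (n + m + 1))" for P :: "nat \<Rightarrow> bool"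
    by (metis add.assoc add.commute le_add_diff_inverse2 not_less_eq_eq Suc_eq_plus1)
  show ?thesis
    by (subst split) (use le gt in blast)
qed

end
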